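(* Let $\varphi$ be an analytic self-mapping of $\mathbb{C}^+$ and let $\Omega=\varphi(\mathbb{C}^+)$. Then the operator $C_\varphi f=f\circ\varphi$ induced by $\varphi$ is a bounded composition operator on the Dirichlet space $\mathfrak{D}(\mathbb{C}^+)$ with dense range if and only if $\varphi$ is univalent and the set of rational functions $\mathbf{R}_\alpha(C^+)$ is dense in the Dirichlet space $\mathfrak{D}(\Omega)$.
   Context: $\mathbb{D}=\{w\in\mathbb{C}:|w|<1\}$ is the unit disc, $\mathbb{C}^+=\{z\in\mathbb{C}:\operatorname{Im} z>0\}$ is the upper half-plane, and $dA$ is Lebesgue area measure. Univalent means analytic and injective. The Dirichlet space $\mathfrak{D}(\mathbb{C}^+)$ consists of all analytic functions $f$ on $\mathbb{C}^+$ with $\int_{\mathbb{C}^+}|f'(z)|^2\,dA(z)<\infty$, with norm given by $\|f\|^2_{\mathfrak{D}(\mathbb{C}^+)}=|f(i)|^2+\int_{\mathbb{C}^+}|f'(z)|^2\,dA(z)$; it is a Hilbert space. For $\Omega=\varphi(\mathbb{C}^+)$ a domain in $\mathbb{C}^+$, the Dirichlet space $\mathfrak{D}(\Omega)$ consists of all analytic functions $f$ on $\Omega$ with $\int_{\Omega}|f'(z)|^2\,dA(z)<\infty$, with norm given by $\|f\|^2_{\mathfrak{D}(\Omega)}=|f(\varphi(i))|^2+\int_{\Omega}|f'(z)|^2\,dA(z)$. Let $\alpha:\mathbb{D}\to\mathbb{C}^+$, $\alpha(w)=i\frac{1-w}{1+w}$, be the conformal map with inverse $\alpha^{-1}(z)=\frac{i-z}{i+z}$,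 and set $\mathbf{R}_\alpha(C^+)=\{P\circ\alpha^{-1}: P \text{ a polynomial}\}$, regarded as functions on $\mathbb{C}^+$ (and, by restriction, as functions on $\Omega\subseteq\mathbb{C}^+$). *)

theory Defs
  imports "HOL-Complex_Analysis.Complex_Analysis"
begin

definition upper_half_plane :: "complex set" where
  "upper_half_plane = {z. Im z > 0}"

text \<open>A function on \<open>S\<close> is represented by its extension by zero to the whole plane.
  Thus functions on \<open>S\<close> are equal iff their representatives are, and the pointwise
  vector space operations respect the representation.\<close>

definition restrict_zero :: "complex set \<Rightarrow> (complex \<Rightarrow> complex) \<Rightarrow> complex \<Rightarrow> complex" where
  "restrict_zero S f = (\<lambda>z. if z \<in> S then f z else 0)"

definition univalent_on :: "(complex \<Rightarrow> complex) \<Rightarrow> complex set \<Rightarrow> bool" where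
  "univalent_on f S \<longleftrightarrow> f analytic_on S \<and> inj_on f S"

text \<open>The next two definitions are meant for open \<open>S\<close>, so that \<open>deriv f z\<close> at a point
  of \<open>S\<close> depends only on \<open>f\<close> on \<open>S\<close>; \<open>lborel\<close> on the complex numbers is area measure.\<close>

definition dirichlet_space :: "complex set \<Rightarrow> (complex \<Rightarrow> complex) set" where
  "dirichlet_space S =
     {f. f analytic_on S \<and> (\<forall>z. z \<notin> S \<longrightarrow> f z = 0) \<and>
         set_integrable lborel S (\<lambda>z. (cmod (deriv f z))\<^sup>2)}"

definition dirichlet_norm :: "complex \<Rightarrow> complex set \<Rightarrow> (complex \<Rightarrow> complex) \<Rightarrow> real" where
  "dirichlet_norm p S f =
     sqrt ((cmod (f p))\<^sup>2 + set_lebesgue_integral lborel S (\<lambda>z. (cmod (deriv f z))\<^sup>2))"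

text \<open>In the next two definitions \<open>V\<close> is a space of functions with norm \<open>N\<close>.\<close>

definition bounded_operator_on ::
  "(complex \<Rightarrow> complex) set \<Rightarrow> ((complex \<Rightarrow> complex) \<Rightarrow> real) \<Rightarrow>
   ((complex \<Rightarrow> complex) \<Rightarrow> complex \<Rightarrow> complex) \<Rightarrow> bool" where
  "bounded_operator_on V N T \<longleftrightarrow>
     (\<forall>f\<in>V. T f \<in> V) \<and>
     (\<forall>f\<in>V. \<forall>g\<in>V. T (\<lambda>z. f z + g z) = (\<lambda>z. T f z + T g z)) \<and>
     (\<forall>f\<in>V. \<forall>c. T (\<lambda>z. c * f z) = (\<lambda>z. c * T f z)) \<and>
     (\<exists>K. \<forall>f\<in>V. N (T f) \<le> K * N f)"

definition dense_in ::
  "(complex \<Rightarrow> complex) set \<Rightarrow> ((complex \<Rightarrow> complex) \<Rightarrow> real) \<Rightarrow>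
   (complex \<Rightarrow> complex) set \<Rightarrow> bool" where
  "dense_in V N A \<longleftrightarrow>
     A \<subseteq> V \<and> (\<forall>f\<in>V. \<forall>e>0. \<exists>g\<in>A. N (\<lambda>z. f z - g z) < e)"

definition composition_operator ::
  "(complex \<Rightarrow> complex) \<Rightarrow> (complex \<Rightarrow> complex) \<Rightarrow> complex \<Rightarrow> complex" where
  "composition_operator \<phi> f = restrict_zero upper_half_plane (f \<circ> \<phi>)"

definition alpha :: "complex \<Rightarrow> complex" where
  "alpha w = \<i> * ((1 - w) / (1 + w))"

definition alpha_inv :: "complex \<Rightarrow> complex" where
  "alpha_inv z = (\<i> - z) / (\<i> + z)"

lemma alpha_in_upper_half_plane:
  assumes "w \<in> ball 0 1"
  shows "alpha w \<in> upper_half_plane"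
proof -
  have n: "(Re w)\<^sup>2 + (Im w)\<^sup>2 < 1"
    using assms by (simp add: cmod_def)
  have ne: "1 + w \<noteq> 0"
    using assms by (auto simp: add_eq_0_iff)
  hence "(1 + Re w)\<^sup>2 + (Im w)\<^sup>2 \<noteq> 0"
    by (auto simp: complex_eq_iff sum_power2_eq_zero_iff)
  hence p: "(1 + Re w)\<^sup>2 + (Im w)\<^sup>2 > 0"
    by (smt (verit) zero_le_power2)
  have "Im (alpha w) = (1 - (Re w)\<^sup>2 - (Im w)\<^sup>2) / ((1 + Re w)\<^sup>2 + (Im w)\<^sup>2)"
    unfolding alpha_def Im_i_times Re_divide
    by (simp add: power2_eq_square algebra_simps)
  thus ?thesis
    using n p by (simp add: upper_half_plane_def)
qed

lemma alpha_inv_in_disc: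
  assumes "z \<in> upper_half_plane"
  shows "alpha_inv z \<in> ball 0 1"
proof -
  have z: "Im z > 0"
    using assms by (simp add: upper_half_plane_def)
  have "(cmod (\<i> - z))\<^sup>2 < (cmod (\<i> + z))\<^sup>2"
    unfolding cmod_power2 using z by (simp add: power2_eq_square algebra_simps)
  hence "cmod (\<i> - z) < cmod (\<i> + z)"
    by (simp add: power2_less_imp_less)
  thus ?thesis
    by (simp add: alpha_inv_def norm_divide divide_simps)
qed

lemma alpha_inv_alpha:
  assumes "w \<in> ball 0 1"
  shows "alpha_inv (alpha w) = w"
proof -
  have ne: "1 + w \<noteq> 0"
    using assms by (auto simp: add_eq_0_iff)
  have "\<i> - alpha w = 2 * \<i> * w / (1 + w)" "\<i> + alpha w = 2 * \<i> / (1 + w)"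
    using ne by (simp_all add: alpha_def divide_simps) (simp_all add: algebra_simps)
  thus ?thesis
    using ne by (simp add: alpha_inv_def)
qed

lemma alpha_alpha_inv:
  assumes "z \<in> upper_half_plane"
  shows "alpha (alpha_inv z) = z"
proof -
  have ne: "\<i> + z \<noteq> 0"
    using assms by (auto simp: upper_half_plane_def complex_eq_iff)
  have "1 - alpha_inv z = 2 * z / (\<i> + z)" "1 + alpha_inv z = 2 * \<i> / (\<i> + z)"
    using ne by (simp_all add: alpha_inv_def divide_simps)
  thus ?thesis
    using ne by (simp add: alpha_def)
qed

definition R_alpha :: "(complex \<Rightarrow> complex) set" where
  "R_alpha = {restrict_zero upper_half_plane (poly P \<circ> alpha_inv) | P. True}"

end

theory Submission
  imports Defs
begin

text \<open>
  Write \<open>U\<close> for the upper half-plane and \<open>D\<^sub>S(f)\<close> for the area integral of \<open>|f'|\<^sup>2\<close> over \<open>S\<close>.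
  The proof rests on three facts about this integral.

  \<^item> It is a conformal invariant: a univalent map \<open>\<phi>\<close> on \<open>S\<close> has Jacobian \<open>|\<phi>'|\<^sup>2\<close>, and therefore
  \<open>D\<^sub>S(f \<circ> \<phi>) = D\<^bsub>\<phi>(S)\<^esub>(f)\<close> (\<open>finite_dirichlet_conformal_iff\<close>). So for univalent \<open>\<phi>\<close> with image
  \<open>\<Omega>\<close>, composition with \<open>\<phi>\<close> is an isometry of the Dirichlet space of \<open>\<Omega>\<close>, normalised
  at \<open>\<phi>(\<i>)\<close>, onto that of \<open>U\<close>, normalised at \<open>\<i>\<close>.

  \<^item> On a convex open set point evaluations are bounded (\<open>point_evaluation_norm_bounded\<close>). By the
  area mean value property of \<open>(f')\<^sup>2\<close>, the integral over a disc controls the derivative at its centre,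
  and integration along a segment then controls the function.

  \<^item> The rational functions \<open>P \<circ> \<alpha>\<^sup>-\<^sup>1\<close> are dense in the Dirichlet space of \<open>U\<close>
  (\<open>R_alpha_dense\<close>). By conformal invariance this is the density of polynomials in the Dirichlet
  space of the disc: a function is approximated by its dilations \<open>f(\<rho>z)\<close>, which are holomorphic
  beyond the closed disc and so are approximated by polynomials with their derivatives.

  Suppose first that \<open>C\<^sub>\<phi>\<close> is bounded with dense range. A function in the range takes the same value
  at two points that \<open>\<phi>\<close> identifies. By continuity of point evaluations every function in the
  Dirichlet space of \<open>U\<close> then does so; since \<open>\<alpha>\<^sup>-\<^sup>1\<close> belongs to this space and is injective, \<open>\<phi>\<close> is
  univalent. Given \<open>f\<close> in the Dirichlet space of \<open>\<Omega>\<close>, approximate \<open>f \<circ> \<phi>\<close> by some \<open>g \<circ> \<phi>\<close>, then \<open>g\<close> by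
  a rational function \<open>r\<close>; boundedness makes \<open>r \<circ> \<phi>\<close> close to \<open>f \<circ> \<phi>\<close>, and by the isometry \<open>r\<close> is
  close to \<open>f\<close> on \<open>\<Omega>\<close>.

  Conversely let \<open>\<phi>\<close> be univalent. Then \<open>C\<^sub>\<phi>\<close> is the restriction from \<open>U\<close> to \<open>\<Omega>\<close> followed by the
  isometry; the restriction does not increase the integral and changes the base point from \<open>\<i>\<close> to
  \<open>\<phi>(\<i>)\<close>, and evaluation at \<open>\<phi>(\<i>)\<close> is bounded; so \<open>C\<^sub>\<phi>\<close> is bounded. If the rational
  functions are dense in the Dirichlet space of \<open>\<Omega>\<close>, their images under the isometry are dense,
  and these lie in the range of \<open>C\<^sub>\<phi>\<close> because the rational
  functions belong to the Dirichlet space of \<open>U\<close>.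
\<close>

section \<open>Change of variables for univalent maps\<close>

text \<open>The plane is identified with \<open>real ^ 2\<close>, where the Jacobian of a map is the determinant of a
matrix and the change of variables formula for multiple integrals applies.\<close>

definition complex_of_vec :: "real^2 \<Rightarrow> complex" where
  "complex_of_vec x = Complex (x $ 1) (x $ 2)"

definition vec_of_complex :: "complex \<Rightarrow> real^2" where
  "vec_of_complex z = vector [Re z, Im z]"

lemma complex_of_vec_inverse [simp]:
  "complex_of_vec (vec_of_complex z) = z" "vec_of_complex (complex_of_vec x) = x"
  by (simp_all add: complex_of_vec_def vec_of_complex_def vec_eq_iff forall_2)

lemma bounded_linear_complex_of_vec: "bounded_linear complex_of_vec"
proof -
  have "linear complex_of_vec"
    by (auto simp: linear_iff complex_of_vec_def complex_eq_iff)
  then show ?thesis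
    by (simp add: linear_conv_bounded_linear)
qed

lemma borel_measurable_complex_of_vec: "complex_of_vec \<in> borel_measurable lborel"
  using borel_measurable_continuous_onI[OF linear_continuous_on[OF bounded_linear_complex_of_vec]]
  by simp

lemma bounded_linear_vec_of_complex: "bounded_linear vec_of_complex"
proof -
  have "linear vec_of_complex"
    by (auto simp: linear_iff vec_of_complex_def vec_eq_iff forall_2)
  then show ?thesis
    by (simp add: linear_conv_bounded_linear)
qed

text \<open>Lebesgue measure is determined by its values on boxes, and the identification maps boxes to
boxes with the same side lengths.\<close>

lemma distr_lborel_complex_of_vec: "distr lborel borel complex_of_vec = lborel"
proof (rule lborel_eqI[symmetric])
  fix l u :: complex
  assume lu: "\<And>b. b \<in> Basis \<Longrightarrow> l \<bullet> b \<le> u \<bullet> b"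
  have meas: "complex_of_vec \<in> borel_measurable lborel"
    by (rule borel_measurable_complex_of_vec)
  have basis: "(Basis :: (real^2) set) = {axis 1 1, axis 2 1}"
    by (simp add: Basis_vec_def UNIV_2 insert_commute)
  have vimage: "complex_of_vec -` box l u = box (vec_of_complex l) (vec_of_complex u)"
    by (auto simp: complex_of_vec_def vec_of_complex_def box_def Basis_complex_def
        Basis_vec_def inner_axis forall_2)
  have "emeasure (distr lborel borel complex_of_vec) (box l u)
      = emeasure lborel (box (vec_of_complex l) (vec_of_complex u))"
    using meas by (simp add: emeasure_distr vimage)
  also have "\<dots> = ennreal (\<Prod>b\<in>Basis. (vec_of_complex u - vec_of_complex l) \<bullet> b)"
    using lu[of 1] lu[of \<i>]
    by (intro emeasure_lborel_box)
       (auto simp: basis inner_axis vec_of_complex_def Basis_complex_def)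
  also have "(\<Prod>b\<in>Basis. (vec_of_complex u - vec_of_complex l) \<bullet> b) = (\<Prod>b\<in>Basis. (u - l) \<bullet> b)"
    by (simp add: basis axis_eq_axis Basis_complex_def inner_axis vec_of_complex_def)
  finally show "emeasure (distr lborel borel complex_of_vec) (box l u)
      = ennreal (\<Prod>b\<in>Basis. (u - l) \<bullet> b)" .
qed simp

text \<open>Measurability lets the integral pass from Borel measure to its completion, and thus to the gauge
integral.\<close>

lemma set_integral_complex_of_vec:
  fixes h :: "complex \<Rightarrow> real"
  assumes "S \<in> sets borel" "set_borel_measurable borel S h"
  shows "set_integrable lborel S h \<longleftrightarrow>
      (\<lambda>x. h (complex_of_vec x)) absolutely_integrable_on (complex_of_vec -` S)" (is ?A)
    and "set_integrable lborel S h \<Longrightarrow> set_lebesgue_integral lborel S h =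
      integral (complex_of_vec -` S) (\<lambda>x. h (complex_of_vec x))" (is "_ \<Longrightarrow> ?B")
proof -
  let ?k = "\<lambda>z. indicator S z *\<^sub>R h z"
  have k: "?k \<in> borel_measurable borel"
    using assms by (simp add: set_borel_measurable_def)
  have m: "complex_of_vec \<in> borel_measurable lborel"
    by (rule borel_measurable_complex_of_vec)
  have kc: "(\<lambda>x. ?k (complex_of_vec x)) \<in> borel_measurable lborel"
    using k m by (rule measurable_compose[rotated])
  have ind: "(\<lambda>x. ?k (complex_of_vec x)) =
      (\<lambda>x. indicator (complex_of_vec -` S) x *\<^sub>R h (complex_of_vec x))"
    by (auto simp: indicator_def)
  have "set_integrable lborel S h \<longleftrightarrow> integrable (distr lborel borel complex_of_vec) ?k"
    by (simp add: set_integrable_def distr_lborel_complex_of_vec)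
  also have "\<dots> \<longleftrightarrow> integrable lborel (\<lambda>x. ?k (complex_of_vec x))"
    using m k by (rule integrable_distr_eq)
  also have "\<dots> \<longleftrightarrow> integrable lebesgue (\<lambda>x. ?k (complex_of_vec x))"
    by (rule integrable_completion[symmetric, OF kc])
  finally show A: ?A
    unfolding set_integrable_def ind .
  assume "set_integrable lborel S h"
  then have *: "set_integrable lebesgue (complex_of_vec -` S) (\<lambda>x. h (complex_of_vec x))"
    using A by simp
  have "set_lebesgue_integral lborel S h = integral\<^sup>L (distr lborel borel complex_of_vec) ?k"
    by (simp add: set_lebesgue_integral_def distr_lborel_complex_of_vec)
  also have "\<dots> = integral\<^sup>L lborel (\<lambda>x. ?k (complex_of_vec x))"
    using m k by (rule integral_distr)
  also have "\<dots> = integral\<^sup>L lebesgue (\<lambda>x. ?k (complex_of_vec x))"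
    by (rule integral_completion[symmetric, OF kc])
  also have "\<dots> = (LINT x:complex_of_vec -` S | lebesgue. h (complex_of_vec x))"
    unfolding set_lebesgue_integral_def ind ..
  also have "\<dots> = integral (complex_of_vec -` S) (\<lambda>x. h (complex_of_vec x))"
    using * by (rule set_lebesgue_integral_eq_integral(2))
  finally show ?B .
qed

lemma set_borel_measurable_continuous_open:
  fixes h :: "complex \<Rightarrow> real"
  assumes "open S" "continuous_on S h"
  shows "set_borel_measurable borel S h"
  using assms borel_measurable_continuous_on_indicator[of S h]
  by (simp add: set_borel_measurable_def)

text \<open>The real Jacobian determinant of a complex differentiable map is the squared modulus of its
derivative, by the Cauchy--Riemann equations. The equivalence of integrability is what carries
membership in Dirichlet spaces from one domain to the other.\<close>

lemma conformal_change_of_variables: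
  fixes h :: "complex \<Rightarrow> real"
  assumes S: "open S" and hol: "\<phi> holomorphic_on S" and inj: "inj_on \<phi> S"
    and cont: "continuous_on (\<phi> ` S) h"
  shows "set_integrable lborel S (\<lambda>z. (cmod (deriv \<phi> z))\<^sup>2 * h (\<phi> z)) \<longleftrightarrow>
      set_integrable lborel (\<phi> ` S) h" (is "?L \<longleftrightarrow> ?R")
    and "set_integrable lborel (\<phi> ` S) h \<Longrightarrow>
      set_lebesgue_integral lborel (\<phi> ` S) h =
      set_lebesgue_integral lborel S (\<lambda>z. (cmod (deriv \<phi> z))\<^sup>2 * h (\<phi> z))"
proof -
  let ?T = "complex_of_vec -` S"
  let ?g = "\<lambda>x. vec_of_complex (\<phi> (complex_of_vec x))"
  let ?g' = "\<lambda>x v. vec_of_complex (deriv \<phi> (complex_of_vec x) * complex_of_vec v)"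
  let ?D = "\<lambda>z. (cmod (deriv \<phi> z))\<^sup>2 * h (\<phi> z)"
  have open_image: "open (\<phi> ` S)"
    using open_mapping_thm3[OF hol S inj] .
  have cont_D: "continuous_on S ?D"
    by (intro continuous_intros holomorphic_on_imp_continuous_on holomorphic_deriv hol S
        continuous_on_compose2[OF cont]) auto
  have openT: "open ?T"
    using S bounded_linear_complex_of_vec
    by (metis continuous_on_open_vimage linear_continuous_on open_UNIV Int_UNIV_right)
  have gT: "?g ` ?T = complex_of_vec -` (\<phi> ` S)"
  proof -
    have "x \<in> ?g ` ?T" if "complex_of_vec x = \<phi> s" "s \<in> S" for x s
      using that by (intro image_eqI[of _ _ "vec_of_complex s"]) (auto, metis complex_of_vec_inverse(2))
    then show ?thesis
      by auto
  qed
  have der: "(?g has_derivative ?g' x) (at x within ?T)" if "x \<in> ?T" for x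
  proof -
    have "(\<phi> has_field_derivative deriv \<phi> (complex_of_vec x)) (at (complex_of_vec x))"
      using that hol S holomorphic_derivI by auto
    then have "(\<phi> has_derivative (*) (deriv \<phi> (complex_of_vec x))) (at (complex_of_vec x))"
      by (simp add: has_field_derivative_def)
    from has_derivative_compose[OF bounded_linear_imp_has_derivative[OF bounded_linear_complex_of_vec] this]
    have "((\<lambda>x. \<phi> (complex_of_vec x)) has_derivative
        (\<lambda>v. deriv \<phi> (complex_of_vec x) * complex_of_vec v)) (at x within ?T)"
      by (simp add: has_derivative_at_withinI)
    then show ?thesis
      by (rule bounded_linear.has_derivative[OF bounded_linear_vec_of_complex])
  qed
  have det: "\<bar>det (matrix (?g' x))\<bar> = (cmod (deriv \<phi> (complex_of_vec x)))\<^sup>2" for x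
    by (simp add: det_2 matrix_def vec_of_complex_def complex_of_vec_def axis_def cmod_power2)
       (simp add: power2_eq_square)
  have injg: "inj_on ?g ?T"
    by (auto simp: inj_on_def) (metis complex_of_vec_inverse inj inj_onD)
  have T: "?T \<in> sets lebesgue"
    using openT by auto
  \<comment> \<open>The formula concerns vector-valued integrands; a real integrand is a vector of length one.\<close>
  let ?v = "\<lambda>x. vec (h (complex_of_vec x)) :: real^1"
  have cv: "(\<lambda>x. ?D (complex_of_vec x)) absolutely_integrable_on ?T \<and>
        integral ?T (\<lambda>x. ?D (complex_of_vec x)) = b \<longleftrightarrow>
      (\<lambda>x. h (complex_of_vec x)) absolutely_integrable_on (complex_of_vec -` (\<phi> ` S)) \<and>
        integral (complex_of_vec -` (\<phi> ` S)) (\<lambda>x. h (complex_of_vec x)) = b" for b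
    using has_absolute_integral_change_of_variables[of ?T ?g ?g' ?v "vec b", OF T der injg]
    unfolding det gT
    by (auto simp: absolutely_integrable_on_1_iff integral_on_1_eq vec_eq_iff)
  have mS: "set_borel_measurable borel S ?D" "S \<in> sets borel"
    using S cont_D by (auto intro: set_borel_measurable_continuous_open)
  have mI: "set_borel_measurable borel (\<phi> ` S) h" "\<phi> ` S \<in> sets borel"
    using open_image cont by (auto intro: set_borel_measurable_continuous_open)
  show iff: "?L \<longleftrightarrow> ?R"
    unfolding set_integral_complex_of_vec(1)[OF mS(2,1)] set_integral_complex_of_vec(1)[OF mI(2,1)]
    using cv by blast
  assume R: ?R
  show "set_lebesgue_integral lborel (\<phi> ` S) h = set_lebesgue_integral lborel S ?D"
    using R iff cv
    unfolding set_integral_complex_of_vec(2)[OF mI(2,1) R]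
      set_integral_complex_of_vec(2)[OF mS(2,1) iff[THEN iffD2, OF R]]
      set_integral_complex_of_vec(1)[OF mS(2,1)] set_integral_complex_of_vec(1)[OF mI(2,1)]
    by metis
qed

section \<open>The area mean value inequality\<close>

text \<open>Power series converge uniformly on smaller closed discs. The agreement at the centre makes the
mean value of the approximant over a disc equal to \<open>h 0\<close>.\<close>

lemma taylor_polynomial_uniform:
  assumes "h holomorphic_on ball 0 R" "0 < r" "r < R" "e > 0"
  obtains P where "poly P 0 = h 0" "\<And>w. w \<in> cball 0 r \<Longrightarrow> cmod (h w - poly P w) < e"
proof -
  define a where "a = (\<lambda>n. (deriv ^^ n) h 0 / fact n)"
  have sums: "(\<lambda>n. a n * w ^ n) sums h w" if "w \<in> ball 0 R" for w
    using holomorphic_power_series[OF assms(1) that] by (simp add: a_def)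
  have "conv_radius a \<ge> ereal R"
  proof (rule conv_radius_geI_ex')
    fix s :: real assume "0 < s" "ereal s < ereal R"
    then show "summable (\<lambda>n. a n * of_real s ^ n)"
      using sums[of "of_real s"] by (auto simp: sums_iff)
  qed
  then have "ereal r < conv_radius a"
    using assms(3) by (metis less_le_trans ereal_less(1) less_ereal.simps(1))
  from powser_uniform_limit[OF this, of 0]
  have "\<forall>\<^sub>F n in sequentially. \<forall>w\<in>cball 0 r.
      dist (\<Sum>i<n. a i * (w - 0) ^ i) (\<Sum>i. a i * (w - 0) ^ i) < e"
    using assms(4) by (rule uniform_limitD)
  then obtain N where N: "\<forall>n\<ge>N. \<forall>w\<in>cball 0 r.
      dist (\<Sum>i<n. a i * (w - 0) ^ i) (\<Sum>i. a i * (w - 0) ^ i) < e"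
    unfolding eventually_sequentially by blast
  \<comment> \<open>At least one term is kept, so that the value at the centre is exact.\<close>
  let ?P = "\<Sum>i<Suc N. monom (a i) i"
  have P: "poly ?P w = (\<Sum>i<Suc N. a i * w ^ i)" for w
    by (simp add: poly_sum poly_monom)
  show ?thesis
  proof
    show "poly ?P 0 = h 0"
      unfolding P by (simp add: a_def power_0_left sum.lessThan_Suc_shift del: sum.lessThan_Suc)
  next
    fix w :: complex assume w: "w \<in> cball 0 r"
    then have "(\<Sum>i. a i * w ^ i) = h w"
      using sums[of w] assms(3) by (auto simp: sums_iff)
    then show "cmod (h w - poly ?P w) < e"
      using N[rule_format, of "Suc N" w] w unfolding P dist_norm by (simp add: norm_minus_commute)
  qed
qed

lemma set_integrable_ball_if_continuous_cball:
  fixes f :: "complex \<Rightarrow> 'b::{banach, second_countable_topology}"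
  assumes "continuous_on (cball a r) f"
  shows "set_integrable lborel (ball a r) f"
proof (rule set_integrable_subset)
  show "set_integrable lborel (cball a r) f"
    unfolding set_integrable_def using assms by (intro borel_integrable_compact) auto
qed auto

text \<open>A rotation by \<open>u\<close> with \<open>u ^ k = -1\<close> preserves the disc and changes the sign of the integrand. This
symmetry replaces integration in polar coordinates.\<close>

lemma monomial_integral_ball_eq_0:
  assumes "k > 0"
  shows "set_lebesgue_integral lborel (ball 0 r) (\<lambda>w. Re (c * w ^ k)) = 0"
proof -
  define u where "u = cis (pi / of_nat k)"
  have "u ^ k = cis (real k * (pi / real k))"
    unfolding u_def by (rule Complex.DeMoivre)
  then have u: "u ^ k = -1" "cmod u = 1" "u \<noteq> 0"
    using assms by (simp_all add: u_def)
  have img: "(\<lambda>w. u * w) ` ball 0 r = ball 0 r"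
  proof -
    have "w \<in> (\<lambda>w. u * w) ` ball 0 r" if "w \<in> ball 0 r" for w
      using that u by (intro image_eqI[of _ _ "w / u"]) (auto simp: norm_divide)
    then show ?thesis
      using u by (auto simp: norm_mult)
  qed
  have "set_lebesgue_integral lborel ((\<lambda>w. u * w) ` ball 0 r) (\<lambda>w. Re (c * w ^ k)) =
      set_lebesgue_integral lborel (ball 0 r)
        (\<lambda>w. (cmod (deriv (\<lambda>w. u * w) w))\<^sup>2 * Re (c * (u * w) ^ k))"
    by (intro conformal_change_of_variables)
       (use u in \<open>auto simp: inj_on_def img intro!: holomorphic_intros continuous_intros
          set_integrable_ball_if_continuous_cball\<close>)
  also have "\<dots> = set_lebesgue_integral lborel (ball 0 r) (\<lambda>w. - Re (c * w ^ k))"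
    using u by (simp add: power_mult_distrib)
  also have "\<dots> = - set_lebesgue_integral lborel (ball 0 r) (\<lambda>w. Re (c * w ^ k))"
    by (simp add: set_lebesgue_integral_def del: times_complex.sel)
  finally show ?thesis
    unfolding img by simp
qed

lemma polynomial_integral_ball:
  "set_lebesgue_integral lborel (ball 0 r) (\<lambda>w. Re (poly P w)) =
     Re (poly P 0) * measure lborel (ball (0::complex) r)"
proof -
  let ?B = "ball (0::complex) r"
  have int: "set_integrable lborel ?B (\<lambda>w. Re (coeff P i * w ^ i))" for i
    by (intro set_integrable_ball_if_continuous_cball continuous_intros)
  have "set_lebesgue_integral lborel ?B (\<lambda>w. Re (poly P w)) =
      (LINT w|lborel. (\<Sum>i\<le>degree P. indicator ?B w *\<^sub>R Re (coeff P i * w ^ i)))"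
    by (simp add: set_lebesgue_integral_def poly_altdef Re_sum sum_distrib_left)
  also have "\<dots> = (\<Sum>i\<le>degree P. set_lebesgue_integral lborel ?B (\<lambda>w. Re (coeff P i * w ^ i)))"
    unfolding set_lebesgue_integral_def
    by (intro Bochner_Integration.integral_sum int[unfolded set_integrable_def])
  also have "\<dots> = set_lebesgue_integral lborel ?B (\<lambda>w. Re (coeff P 0 * w ^ 0))"
    by (subst sum.remove[of _ 0]) (auto intro!: sum.neutral monomial_integral_ball_eq_0 simp del: times_complex.sel)
  also have "\<dots> = Re (poly P 0) * measure lborel ?B"
    by (simp add: set_lebesgue_integral_def poly_0_coeff_0)
  finally show ?thesis .
qed

text \<open>The mean value property holds for polynomials by \<open>polynomial_integral_ball\<close> and passes to \<open>h\<close> by uniform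
approximation on the disc.\<close>

lemma norm_center_le_integral_ball:
  assumes hol: "h holomorphic_on ball 0 R" and r: "0 < r" "r < R"
  shows "cmod (h 0) * measure lborel (ball (0::complex) r) \<le>
      set_lebesgue_integral lborel (ball 0 r) (\<lambda>w. cmod (h w))"
proof (rule field_le_epsilon)
  fix d :: real assume d: "d > 0"
  let ?B = "ball (0::complex) r"
  let ?m = "measure lborel ?B"
  define e where "e = d / (?m + 1)"
  have e: "e > 0" "e * ?m \<le> d"
    using d by (auto simp: e_def divide_simps add_pos_nonneg add_nonneg_pos algebra_simps)
  \<comment> \<open>A unimodular factor makes the value at the centre real and nonnegative, so that only
    real parts need to be integrated.\<close>
  obtain u where u: "cmod u = 1" "u * h 0 = of_real (cmod (h 0))"
  proof (cases "h 0 = 0")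
    case True then show ?thesis using that[of 1] by simp
  next
    case False
    then show ?thesis
      using that[of "of_real (cmod (h 0)) / h 0"] by (simp add: norm_divide)
  qed
  have "(\<lambda>w. u * h w) holomorphic_on ball 0 R"
    by (intro holomorphic_intros hol)
  from taylor_polynomial_uniform[OF this r e(1)]
  obtain P where P: "poly P 0 = u * h 0" "\<And>w. w \<in> cball 0 r \<Longrightarrow> cmod (u * h w - poly P w) < e"
    by blast
  have hcont: "continuous_on (cball 0 r) h"
    using r by (intro holomorphic_on_imp_continuous_on holomorphic_on_subset[OF hol]) auto
  have "cmod (h 0) * ?m = set_lebesgue_integral lborel ?B (\<lambda>w. Re (poly P w))"
    using P(1) u by (simp add: polynomial_integral_ball)
  also have "\<dots> \<le> set_lebesgue_integral lborel ?B (\<lambda>w. cmod (h w) + e)"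
  proof (rule set_integral_mono)
    show "Re (poly P w) \<le> cmod (h w) + e" if "w \<in> ?B" for w
    proof -
      have "Re (poly P w) \<le> cmod (poly P w)" by (rule complex_Re_le_cmod)
      also have "\<dots> \<le> cmod (u * h w) + cmod (u * h w - poly P w)"
        by (metis norm_minus_commute norm_triangle_sub)
      also have "\<dots> \<le> cmod (h w) + e"
        using P(2)[of w] that u by (simp add: norm_mult less_imp_le)
      finally show ?thesis .
    qed
  qed (intro set_integrable_ball_if_continuous_cball continuous_intros hcont)+
  also have "\<dots> = set_lebesgue_integral lborel ?B (\<lambda>w. cmod (h w)) + e * ?m"
    by (subst set_integral_add)
       (auto intro!: set_integrable_ball_if_continuous_cball continuous_intros hcont
         simp: set_lebesgue_integral_def)
  also have "\<dots> \<le> set_lebesgue_integral lborel ?B (\<lambda>w. cmod (h w)) + d"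
    using e by simp
  finally show "cmod (h 0) * ?m \<le> set_lebesgue_integral lborel ?B (\<lambda>w. cmod (h w)) + d" .
qed

section \<open>The Dirichlet integral and its conformal invariance\<close>

text \<open>In contrast to \<open>dirichlet_space\<close>, nothing is demanded of \<open>f\<close> outside \<open>S\<close>. This makes the notion
stable under composition and restriction of the domain.\<close>

definition finite_dirichlet :: "complex set \<Rightarrow> (complex \<Rightarrow> complex) \<Rightarrow> bool" where
  "finite_dirichlet S f \<longleftrightarrow>
     f holomorphic_on S \<and> set_integrable lborel S (\<lambda>z. (cmod (deriv f z))\<^sup>2)"

definition dirichlet_integral :: "complex set \<Rightarrow> (complex \<Rightarrow> complex) \<Rightarrow> real" where
  "dirichlet_integral S f = set_lebesgue_integral lborel S (\<lambda>z. (cmod (deriv f z))\<^sup>2)"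

text \<open>By the chain rule the integrand of \<open>f \<circ> \<phi>\<close> is that of \<open>f\<close>, taken at \<open>\<phi> z\<close>, times the Jacobian of \<open>\<phi>\<close>.\<close>

lemma finite_dirichlet_conformal_iff:
  assumes S: "open S" and \<phi>: "\<phi> holomorphic_on S" "inj_on \<phi> S"
    and f: "f holomorphic_on \<phi> ` S"
  shows "finite_dirichlet S (f \<circ> \<phi>) \<longleftrightarrow> finite_dirichlet (\<phi> ` S) f"
    and "finite_dirichlet (\<phi> ` S) f \<Longrightarrow>
      dirichlet_integral S (f \<circ> \<phi>) = dirichlet_integral (\<phi> ` S) f"
proof -
  have open_image: "open (\<phi> ` S)"
    using open_mapping_thm3[OF \<phi>(1) S \<phi>(2)] .
  have comp: "f \<circ> \<phi> holomorphic_on S"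
    using \<phi>(1) f by (intro holomorphic_on_compose) auto
  have chain: "(cmod (deriv (f \<circ> \<phi>) z))\<^sup>2 = (cmod (deriv \<phi> z))\<^sup>2 * (cmod (deriv f (\<phi> z)))\<^sup>2"
    if "z \<in> S" for z
  proof -
    have "\<phi> field_differentiable at z" "f field_differentiable at (\<phi> z)"
      using that \<phi>(1) f S open_image by (auto intro: holomorphic_on_imp_differentiable_at)
    from deriv_chain[OF this] show ?thesis
      by (simp add: norm_mult power_mult_distrib)
  qed
  have cont: "continuous_on (\<phi> ` S) (\<lambda>w. (cmod (deriv f w))\<^sup>2)"
    by (intro continuous_intros holomorphic_on_imp_continuous_on holomorphic_deriv f open_image)
  note cv = conformal_change_of_variables[OF S \<phi> cont]
  have int: "set_integrable lborel S (\<lambda>z. (cmod (deriv (f \<circ> \<phi>) z))\<^sup>2) \<longleftrightarrow>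
      set_integrable lborel (\<phi> ` S) (\<lambda>w. (cmod (deriv f w))\<^sup>2)"
    unfolding cv(1)[symmetric] by (intro set_integrable_cong refl chain)
  show "finite_dirichlet S (f \<circ> \<phi>) \<longleftrightarrow> finite_dirichlet (\<phi> ` S) f"
    using f comp int by (simp add: finite_dirichlet_def)
  assume "finite_dirichlet (\<phi> ` S) f"
  then have "dirichlet_integral (\<phi> ` S) f =
      set_lebesgue_integral lborel S (\<lambda>z. (cmod (deriv \<phi> z))\<^sup>2 * (cmod (deriv f (\<phi> z)))\<^sup>2)"
    unfolding dirichlet_integral_def finite_dirichlet_def using cv(2) by blast
  also have "\<dots> = dirichlet_integral S (f \<circ> \<phi>)"
    unfolding dirichlet_integral_def using S
    by (intro set_lebesgue_integral_cong) (auto simp: chain)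
  finally show "dirichlet_integral S (f \<circ> \<phi>) = dirichlet_integral (\<phi> ` S) f" ..
qed

lemma dirichlet_integral_nonneg: "dirichlet_integral S f \<ge> 0"
  by (simp add: dirichlet_integral_def set_lebesgue_integral_def)

lemma finite_dirichlet_subset:
  assumes "finite_dirichlet S f" "open T" "T \<subseteq> S"
  shows "finite_dirichlet T f" "dirichlet_integral T f \<le> dirichlet_integral S f"
proof -
  show T: "finite_dirichlet T f"
    using assms unfolding finite_dirichlet_def
    by (auto intro: holomorphic_on_subset set_integrable_subset)
  show "dirichlet_integral T f \<le> dirichlet_integral S f"
    unfolding dirichlet_integral_def set_lebesgue_integral_def
    using T assms(1,3) unfolding finite_dirichlet_def set_integrable_def
    by (intro integral_mono) (auto simp: indicator_def)
qed

lemma dirichlet_cong: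
  assumes "open S" "\<And>z. z \<in> S \<Longrightarrow> f z = g z"
  shows "finite_dirichlet S f \<longleftrightarrow> finite_dirichlet S g"
    and "dirichlet_integral S f = dirichlet_integral S g"
proof -
  have d: "deriv f z = deriv g z" if "z \<in> S" for z
    using assms that by (intro deriv_cong_ev eventually_nhds_in_open[THEN eventually_mono]) auto
  show "finite_dirichlet S f \<longleftrightarrow> finite_dirichlet S g"
    unfolding finite_dirichlet_def using assms(2) d
    by (intro conj_cong holomorphic_cong set_integrable_cong) auto
  show "dirichlet_integral S f = dirichlet_integral S g"
    unfolding dirichlet_integral_def using assms(1) d
    by (intro set_lebesgue_integral_cong) auto
qed

text \<open>The parallelogram law, which comes from the pointwise identity for \<open>f'\<close> and \<open>g'\<close>. Besides
closure under sums and differences it gives a triangle inequality up to a factor, and it drives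
the convergence argument for dilations.\<close>

lemma dirichlet_parallelogram:
  assumes S: "open S" and f: "finite_dirichlet S f" and g: "finite_dirichlet S g"
  shows "finite_dirichlet S (\<lambda>z. f z + g z)" "finite_dirichlet S (\<lambda>z. f z - g z)"
    and "dirichlet_integral S (\<lambda>z. f z + g z) + dirichlet_integral S (\<lambda>z. f z - g z) =
      2 * dirichlet_integral S f + 2 * dirichlet_integral S g"
proof -
  have hol: "f holomorphic_on S" "g holomorphic_on S"
    and int: "set_integrable lborel S (\<lambda>z. (cmod (deriv f z))\<^sup>2)"
      "set_integrable lborel S (\<lambda>z. (cmod (deriv g z))\<^sup>2)"
    using f g by (auto simp: finite_dirichlet_def)
  have diff: "f field_differentiable at z" "g field_differentiable at z" if "z \<in> S" for z
    using that hol S by (auto intro: holomorphic_on_imp_differentiable_at)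
  have parallelogram: "(cmod (a + b))\<^sup>2 + (cmod (a - b))\<^sup>2 = 2 * (cmod a)\<^sup>2 + 2 * (cmod b)\<^sup>2" for a b
    unfolding cmod_power2 by (simp add: power2_eq_square algebra_simps)
  have pt: "(cmod (deriv (\<lambda>z. f z + g z) z))\<^sup>2 + (cmod (deriv (\<lambda>z. f z - g z) z))\<^sup>2 =
      2 * (cmod (deriv f z))\<^sup>2 + 2 * (cmod (deriv g z))\<^sup>2" if "z \<in> S" for z
    using diff[OF that] parallelogram by simp
  have bound: "set_integrable lborel S (\<lambda>z. 2 * (cmod (deriv f z))\<^sup>2 + 2 * (cmod (deriv g z))\<^sup>2)"
    by (intro set_integral_add set_integrable_mult_right int)
  have fin: "finite_dirichlet S h"
    if "h holomorphic_on S" "\<And>z. z \<in> S \<Longrightarrow> (cmod (deriv h z))\<^sup>2 \<le>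
      2 * (cmod (deriv f z))\<^sup>2 + 2 * (cmod (deriv g z))\<^sup>2" for h
  proof -
    have "continuous_on S (\<lambda>z. (cmod (deriv h z))\<^sup>2)"
      by (intro continuous_intros holomorphic_on_imp_continuous_on holomorphic_deriv that S)
    from set_borel_measurable_continuous_open[OF S this]
    have "set_integrable lborel S (\<lambda>z. (cmod (deriv h z))\<^sup>2)"
      by (intro set_integrable_bound[OF bound])
         (use that in \<open>auto simp: set_borel_measurable_def\<close>)
    then show ?thesis
      using that by (simp add: finite_dirichlet_def)
  qed
  show plus: "finite_dirichlet S (\<lambda>z. f z + g z)"
  proof (rule fin)
    show "(cmod (deriv (\<lambda>z. f z + g z) z))\<^sup>2 \<le> 2 * (cmod (deriv f z))\<^sup>2 + 2 * (cmod (deriv g z))\<^sup>2"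
      if "z \<in> S" for z
      by (rule order_trans[OF _ eq_refl[OF pt[OF that]]]) simp
  qed (intro holomorphic_intros hol)
  show minus: "finite_dirichlet S (\<lambda>z. f z - g z)"
  proof (rule fin)
    show "(cmod (deriv (\<lambda>z. f z - g z) z))\<^sup>2 \<le> 2 * (cmod (deriv f z))\<^sup>2 + 2 * (cmod (deriv g z))\<^sup>2"
      if "z \<in> S" for z
      by (rule order_trans[OF _ eq_refl[OF pt[OF that]]]) simp
  qed (intro holomorphic_intros hol)
  have "dirichlet_integral S (\<lambda>z. f z + g z) + dirichlet_integral S (\<lambda>z. f z - g z) =
      set_lebesgue_integral lborel S (\<lambda>z. (cmod (deriv (\<lambda>z. f z + g z) z))\<^sup>2 +
        (cmod (deriv (\<lambda>z. f z - g z) z))\<^sup>2)"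
    unfolding dirichlet_integral_def using plus minus
    by (intro set_integral_add(2)[symmetric]) (auto simp: finite_dirichlet_def)
  also have "\<dots> = set_lebesgue_integral lborel S
      (\<lambda>z. 2 * (cmod (deriv f z))\<^sup>2 + 2 * (cmod (deriv g z))\<^sup>2)"
    using S pt by (intro set_lebesgue_integral_cong) auto
  also have "\<dots> = 2 * dirichlet_integral S f + 2 * dirichlet_integral S g"
    unfolding dirichlet_integral_def
    by (subst set_integral_add(2)) (auto intro!: set_integrable_mult_right int)
  finally show "dirichlet_integral S (\<lambda>z. f z + g z) + dirichlet_integral S (\<lambda>z. f z - g z) =
      2 * dirichlet_integral S f + 2 * dirichlet_integral S g" .
qed

lemma dirichlet_integral_add_le:
  assumes "open S" "finite_dirichlet S f" "finite_dirichlet S g"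
  shows "dirichlet_integral S (\<lambda>z. f z + g z) \<le> 2 * dirichlet_integral S f + 2 * dirichlet_integral S g"
  using dirichlet_parallelogram(3)[OF assms] dirichlet_integral_nonneg[of S "\<lambda>z. f z - g z"]
  by simp

lemma nn_integral_dirichlet:
  assumes "finite_dirichlet S f"
  shows "(\<integral>\<^sup>+z. ennreal (indicator S z * (cmod (deriv f z))\<^sup>2) \<partial>lborel) = ennreal (dirichlet_integral S f)"
  using assms unfolding finite_dirichlet_def dirichlet_integral_def set_lebesgue_integral_def set_integrable_def
  by (subst nn_integral_eq_integral) auto

section \<open>Boundedness of point evaluations\<close>

text \<open>The mean value inequality is applied to the holomorphic function \<open>(f')\<^sup>2\<close>, after a translation
of the disc to the origin. The slightly larger disc of radius \<open>R\<close> makes \<open>f'\<close> continuous up to the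
boundary of the disc of radius \<open>r\<close>.\<close>

lemma norm_deriv_le_dirichlet_integral:
  assumes f: "finite_dirichlet S f" and S: "open S" and r: "r > 0" and R: "r < R" "ball a R \<subseteq> S"
  shows "(cmod (deriv f a))\<^sup>2 * measure lborel (ball (0::complex) r) \<le> dirichlet_integral S f"
proof -
  have f_hol: "f holomorphic_on ball a R"
    using f R(2) by (auto simp: finite_dirichlet_def intro: holomorphic_on_subset)
  have img: "(+) a ` ball 0 s = ball a s" for s
    by (simp add: ball_translation)
  have comp: "f \<circ> (+) a holomorphic_on ball 0 R"
    using f_hol by (intro holomorphic_on_compose holomorphic_intros) (simp add: img)
  have fin: "finite_dirichlet (ball a r) f" and le: "dirichlet_integral (ball a r) f \<le> dirichlet_integral S f"
    using finite_dirichlet_subset[OF f, of "ball a r"] R subset_ball[of r R a] by auto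
  have hd: "(\<lambda>w. (deriv (f \<circ> (+) a) w)\<^sup>2) holomorphic_on ball 0 R"
    by (intro holomorphic_intros comp) auto
  have d0: "deriv (f \<circ> (+) a) 0 = deriv f a"
    by (subst deriv_chain)
       (use f_hol R r in \<open>auto intro!: holomorphic_on_imp_differentiable_at[OF f_hol] derivative_eq_intros simp: deriv_add\<close>)
  have "(cmod (deriv f a))\<^sup>2 * measure lborel (ball (0::complex) r) \<le> dirichlet_integral (ball 0 r) (f \<circ> (+) a)"
    using norm_center_le_integral_ball[OF hd r R(1)]
    by (simp add: d0 norm_power dirichlet_integral_def)
  also have "\<dots> = dirichlet_integral (ball a r) f"
    using finite_dirichlet_conformal_iff(2)[of "ball 0 r" "(+) a" f] fin
      holomorphic_on_add[OF holomorphic_on_const holomorphic_on_ident, of a "ball 0 r"]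
    unfolding img by (simp add: finite_dirichlet_def)
  finally show ?thesis
    using le by simp
qed

text \<open>Some \<open>e\<close>-neighbourhood of the segment from \<open>p\<close> to \<open>z\<close> lies in \<open>S\<close>. On the segment the derivative
is therefore at most a constant times the square root of the Dirichlet integral.\<close>

lemma point_evaluation_bounded:
  assumes S: "open S" "convex S" and "p \<in> S" "z \<in> S"
  obtains K where "K \<ge> 0"
    "\<And>f. finite_dirichlet S f \<Longrightarrow> (cmod (f z - f p))\<^sup>2 \<le> K * dirichlet_integral S f"
proof -
  have "closed_segment p z \<subseteq> S"
    using assms by (simp add: closed_segment_subset)
  then obtain e where e: "e > 0" "(\<Union>x\<in>closed_segment p z. cball x e) \<subseteq> S"
    using compact_subset_open_imp_cball_epsilon_subset[of "closed_segment p z" S] S by auto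
  define m where "m = measure lborel (ball (0::complex) (e / 2))"
  have m: "m > 0"
    using e content_ball_pos[of "e / 2" "0::complex"] by (simp add: m_def)
  show ?thesis
  proof (rule that[of "(cmod (z - p))\<^sup>2 / m"])
    fix f assume f: "finite_dirichlet S f"
    define B where "B = sqrt (dirichlet_integral S f / m)"
    have ball_subset: "ball w e \<subseteq> S" if "w \<in> closed_segment p z" for w
      using that e(2) ball_subset_cball[of w e] by blast
    have "cmod (deriv f w) \<le> B" if "w \<in> closed_segment p z" for w
    proof -
      have "(cmod (deriv f w))\<^sup>2 * m \<le> dirichlet_integral S f"
        unfolding m_def using that e(1) ball_subset
        by (intro norm_deriv_le_dirichlet_integral[where R = e] f S) auto
      then show ?thesis
        unfolding B_def using m by (intro real_le_rsqrt) (simp add: field_simps)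
    qed
    moreover have "(f has_field_derivative deriv f w) (at w within closed_segment p z)"
      if "w \<in> closed_segment p z" for w
      using that f \<open>closed_segment p z \<subseteq> S\<close> S
      unfolding finite_dirichlet_def
      by (intro has_field_derivative_at_within[OF holomorphic_derivI[of f S]]) auto
    ultimately have "cmod (f z - f p) \<le> B * cmod (z - p)"
      by (intro field_differentiable_bound[of "closed_segment p z" f "deriv f"]) auto
    then have "(cmod (f z - f p))\<^sup>2 \<le> (B * cmod (z - p))\<^sup>2"
      by (intro power_mono) auto
    also have "\<dots> = (cmod (z - p))\<^sup>2 / m * dirichlet_integral S f"
      using m dirichlet_integral_nonneg[of S f] by (simp add: B_def power_mult_distrib)
    finally show "(cmod (f z - f p))\<^sup>2 \<le> (cmod (z - p))\<^sup>2 / m * dirichlet_integral S f" .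
  qed (use m in auto)
qed

section \<open>Density of polynomials on the unit disc\<close>

text \<open>Pointwise convergence of the derivatives implies convergence in mean square if no integral exceeds
that of the limit.
By Fatou's lemma the integral of \<open>|f' + F\<^sub>n'|\<^sup>2\<close> is asymptotically at least four times that of
\<open>|f'|\<^sup>2\<close>; the parallelogram law leaves nothing for \<open>f - F\<^sub>n\<close>.\<close>

lemma dirichlet_converges_if_pointwise:
  assumes S: "open S" and F: "\<And>n. finite_dirichlet S (F n)" and f: "finite_dirichlet S f"
    and le: "\<And>n. dirichlet_integral S (F n) \<le> dirichlet_integral S f"
    and lim: "\<And>z. z \<in> S \<Longrightarrow> (\<lambda>n. deriv (F n) z) \<longlonglongrightarrow> deriv f z"
    and e: "e > 0"
  shows "\<exists>n. dirichlet_integral S (\<lambda>z. f z - F n z) < e"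
proof -
  let ?G = "\<lambda>n z. f z + F n z" and ?D = "dirichlet_integral S f"
  let ?u = "\<lambda>n z. ennreal (indicator S z * (cmod (deriv (?G n) z))\<^sup>2)"
  have hol: "f holomorphic_on S" "\<And>n. F n holomorphic_on S"
    using f F by (auto simp: finite_dirichlet_def)
  have G: "finite_dirichlet S (?G n)" for n
    by (rule dirichlet_parallelogram(1)[OF S f F])
  have "(\<lambda>n. indicator S z * (cmod (deriv (?G n) z))\<^sup>2) \<longlonglongrightarrow>
      4 * (indicator S z * (cmod (deriv f z))\<^sup>2)" for z
  proof (cases "z \<in> S")
    case True
    then have "f field_differentiable at z" "\<And>n. F n field_differentiable at z"
      using hol S by (auto intro: holomorphic_on_imp_differentiable_at)
    then have "deriv (?G n) z = deriv f z + deriv (F n) z" for n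
      by simp
    moreover have "(\<lambda>n. (cmod (deriv f z + deriv (F n) z))\<^sup>2) \<longlonglongrightarrow> (cmod (deriv f z + deriv f z))\<^sup>2"
      by (intro tendsto_intros lim True)
    moreover have "(cmod (deriv f z + deriv f z))\<^sup>2 = 4 * (cmod (deriv f z))\<^sup>2"
      by (simp add: mult_2[symmetric] norm_mult power_mult_distrib)
    ultimately show ?thesis
      using True by simp
  qed simp
  then have "(\<lambda>n. ?u n z) \<longlonglongrightarrow> ennreal (4 * (indicator S z * (cmod (deriv f z))\<^sup>2))" for z
    by (rule tendsto_ennrealI)
  then have liminf: "liminf (\<lambda>n. ?u n z) = ennreal (4 * (indicator S z * (cmod (deriv f z))\<^sup>2))" for z
    by (intro lim_imp_Liminf) auto
  have int_f: "integrable lborel (\<lambda>z. indicator S z * (cmod (deriv f z))\<^sup>2)"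
    using f by (simp add: finite_dirichlet_def set_integrable_def)
  have "ennreal (4 * ?D) = (\<integral>\<^sup>+z. liminf (\<lambda>n. ?u n z) \<partial>lborel)"
    unfolding liminf dirichlet_integral_def set_lebesgue_integral_def
    by (subst nn_integral_eq_integral) (use int_f in auto)
  also have "\<dots> \<le> liminf (\<lambda>n. \<integral>\<^sup>+z. ?u n z \<partial>lborel)"
  proof (rule nn_integral_liminf)
    show "?u n \<in> borel_measurable lborel" for n
      using G[of n] unfolding finite_dirichlet_def set_integrable_def
      by (auto dest!: borel_measurable_integrable)
  qed
  also have "\<dots> = liminf (\<lambda>n. ennreal (dirichlet_integral S (?G n)))"
    by (simp add: nn_integral_dirichlet[OF G])
  finally have fatou: "ennreal (4 * ?D) \<le> liminf (\<lambda>n. ennreal (dirichlet_integral S (?G n)))" .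
  \<comment> \<open>A negative bound is treated separately, because
    negative reals are truncated to zero in \<^typ>\<open>ennreal\<close>.\<close>
  have "\<exists>n. 4 * ?D - e < dirichlet_integral S (?G n)"
  proof (cases "4 * ?D - e < 0")
    case True
    then show ?thesis
      using dirichlet_integral_nonneg less_le_trans by blast
  next
    case False
    then have "ennreal (4 * ?D - e) < ennreal (4 * ?D)"
      using e by (intro ennreal_lessI) auto
    with fatou have "ennreal (4 * ?D - e) < liminf (\<lambda>n. ennreal (dirichlet_integral S (?G n)))"
      by simp
    from less_LiminfD[OF this] obtain n where "ennreal (4 * ?D - e) < ennreal (dirichlet_integral S (?G n))"
      by (auto simp: eventually_sequentially)
    then show ?thesis
      using False dirichlet_integral_nonneg by (auto simp: ennreal_less_iff)
  qed
  then obtain n where "4 * ?D - e < dirichlet_integral S (?G n)" ..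
  then have "dirichlet_integral S (\<lambda>z. f z - F n z) < e"
    using dirichlet_parallelogram(3)[OF S f F[of n]] le[of n] by linarith
  then show ?thesis ..
qed

text \<open>The Dirichlet integral of the dilation \<open>f(\<rho>z)\<close> is that of \<open>f\<close> over the smaller disc of radius \<open>\<rho>\<close>,
by conformal invariance, so the mass does not increase as \<open>\<rho>\<close> tends to 1.\<close>

lemma dilation_approximates:
  assumes f: "finite_dirichlet (ball 0 1) f" and e: "e > 0"
  obtains \<rho> :: real where "0 < \<rho>" "\<rho> < 1"
    "finite_dirichlet (ball 0 1) (\<lambda>z. f (of_real \<rho> * z))"
    "dirichlet_integral (ball 0 1) (\<lambda>z. f z - f (of_real \<rho> * z)) < e"
proof -
  define \<rho> :: "nat \<Rightarrow> real" where "\<rho> n = 1 - 1 / (real n + 2)" for n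
  let ?F = "\<lambda>n z. f (of_real (\<rho> n) * z)"
  have \<rho>: "0 < \<rho> n" "\<rho> n < 1" for n
    by (auto simp: \<rho>_def field_simps)
  have \<rho>_lim: "\<rho> \<longlonglongrightarrow> 1"
    unfolding \<rho>_def by real_asymp
  have f_hol: "f holomorphic_on ball 0 1"
    using f by (simp add: finite_dirichlet_def)
  have img: "(\<lambda>z. of_real (\<rho> n) * z) ` ball (0::complex) 1 = ball 0 (\<rho> n)" for n
  proof -
    have "w \<in> (\<lambda>z. of_real (\<rho> n) * z) ` ball (0::complex) 1" if "w \<in> ball 0 (\<rho> n)" for w
      using that \<rho>[of n] by (intro image_eqI[of _ _ "w / of_real (\<rho> n)"]) (auto simp: norm_divide)
    then show ?thesis
      using \<rho>[of n] by (auto simp: norm_mult)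
  qed
  have sub: "ball 0 (\<rho> n) \<subseteq> ball (0::complex) 1" for n
    using \<rho>[of n] by (intro subset_ball) auto
  note sub_f = finite_dirichlet_subset[OF f open_ball sub]
  have F: "finite_dirichlet (ball 0 1) (?F n)"
    "dirichlet_integral (ball 0 1) (?F n) \<le> dirichlet_integral (ball 0 1) f" for n
  proof -
    have lin: "(\<lambda>z. of_real (\<rho> n) * z) holomorphic_on ball (0::complex) 1"
      "inj_on (\<lambda>z. of_real (\<rho> n) * z) (ball (0::complex) 1)"
      using \<rho>[of n] by (auto simp: inj_on_def intro!: holomorphic_intros)
    have fh: "f holomorphic_on (\<lambda>z. of_real (\<rho> n) * z) ` ball (0::complex) 1"
      unfolding img using f_hol sub by (rule holomorphic_on_subset)
    show "finite_dirichlet (ball 0 1) (?F n)"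
      using finite_dirichlet_conformal_iff(1)[OF open_ball lin fh] sub_f(1)[of n]
      unfolding img by (simp add: o_def)
    show "dirichlet_integral (ball 0 1) (?F n) \<le> dirichlet_integral (ball 0 1) f"
      using finite_dirichlet_conformal_iff(2)[OF open_ball lin fh] sub_f[of n]
      unfolding img by (simp add: o_def)
  qed
  have lim: "(\<lambda>n. deriv (?F n) z) \<longlonglongrightarrow> deriv f z" if z: "z \<in> ball 0 1" for z
  proof -
    have in_ball: "of_real (\<rho> n) * z \<in> ball 0 1" for n
      using z img[of n] sub[of n] by blast
    have "deriv (?F n) z = deriv f (of_real (\<rho> n) * z) * of_real (\<rho> n)" for n
    proof -
      have "(f has_field_derivative deriv f (of_real (\<rho> n) * z)) (at (of_real (\<rho> n) * z))"
        using holomorphic_derivI[OF f_hol open_ball in_ball] .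
      then have "(?F n has_field_derivative deriv f (of_real (\<rho> n) * z) * of_real (\<rho> n)) (at z)"
        by (rule DERIV_chain2) (auto intro!: derivative_eq_intros)
      then show ?thesis
        by (rule DERIV_imp_deriv)
    qed
    moreover have "isCont (deriv f) z"
      using holomorphic_deriv[OF f_hol open_ball] z
      by (meson holomorphic_on_imp_continuous_on continuous_on_eq_continuous_at open_ball)
    then have "(\<lambda>n. deriv f (of_real (\<rho> n) * z)) \<longlonglongrightarrow> deriv f z"
      by (rule isCont_tendsto_compose) (use tendsto_mult[OF tendsto_of_real[OF \<rho>_lim] tendsto_const[of z]] in simp)
    then have "(\<lambda>n. deriv f (of_real (\<rho> n) * z) * of_real (\<rho> n)) \<longlonglongrightarrow> deriv f z * of_real 1"
      by (intro tendsto_intros \<rho>_lim)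
    ultimately show ?thesis
      by simp
  qed
  obtain n where "dirichlet_integral (ball 0 1) (\<lambda>z. f z - ?F n z) < e"
    using dirichlet_converges_if_pointwise[OF open_ball F(1) f F(2) lim e] by blast
  with that[of "\<rho> n"] \<rho> F(1) show ?thesis
    by blast
qed

lemma polynomial_antiderivative:
  fixes Q :: "complex poly"
  obtains P where "pderiv P = Q" "poly P 0 = c"
proof
  let ?P = "[:c:] + (\<Sum>i\<le>degree Q. monom (coeff Q i / of_nat (Suc i)) (Suc i))"
  have "coeff (pderiv ?P) n = coeff Q n" for n
    by (simp add: coeff_pderiv coeff_sum coeff_eq_0 del: of_nat_Suc)
  then show "pderiv ?P = Q"
    by (rule poly_eqI)
  show "poly ?P 0 = c"
    by (simp add: poly_sum poly_monom)
qed

lemma deriv_poly: "deriv (poly P) z = poly (pderiv P) (z :: complex)"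
  by (rule DERIV_imp_deriv) (rule poly_DERIV)

lemma finite_dirichlet_poly: "finite_dirichlet (ball 0 1) (poly P)"
  unfolding finite_dirichlet_def deriv_poly
  by (intro conjI set_integrable_ball_if_continuous_cball continuous_intros holomorphic_intros)

text \<open>The derivative of a dilation is holomorphic beyond the closed disc, hence uniformly close to a
polynomial \<open>Q\<close>. The antiderivative of \<open>Q\<close> with the right value at 0 is the approximant.\<close>

lemma polynomials_dense_disc:
  assumes f: "finite_dirichlet (ball 0 1) f" and e: "e > 0"
  obtains P where "poly P 0 = f 0" "dirichlet_integral (ball 0 1) (\<lambda>z. f z - poly P z) < e"
proof -
  let ?B = "ball (0::complex) 1"
  obtain \<rho> :: real where \<rho>: "0 < \<rho>" "\<rho> < 1" and g: "finite_dirichlet ?B (\<lambda>z. f (of_real \<rho> * z))"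
    and fg: "dirichlet_integral ?B (\<lambda>z. f z - f (of_real \<rho> * z)) < e / 4"
    using dilation_approximates[OF f, of "e / 4"] e by auto
  define g where "g = (\<lambda>z. f (of_real \<rho> * z))"
  let ?m = "measure lborel ?B"
  \<comment> \<open>The squared uniform error times the area of the disc is to be at most \<open>e / 8\<close>;
    adding 1 to the area makes the denominator positive at sight.\<close>
  define d where "d = sqrt (e / (8 * (?m + 1)))"
  have m: "?m + 1 > 0"
    by (simp add: add_nonneg_pos)
  have d: "d > 0" "d\<^sup>2 * ?m \<le> e / 8"
    using e m by (auto simp: d_def field_simps)
  have g_hol: "g holomorphic_on ball 0 (1 / \<rho>)"
  proof -
    have "f \<circ> (\<lambda>z. of_real \<rho> * z) holomorphic_on ball 0 (1 / \<rho>)"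
    proof (rule holomorphic_on_compose_gen)
      show "f holomorphic_on ?B"
        using f by (simp add: finite_dirichlet_def)
      show "(\<lambda>z. of_real \<rho> * z) ` ball 0 (1 / \<rho>) \<subseteq> ?B"
        using \<rho> by (auto simp: norm_mult field_simps)
    qed (intro holomorphic_intros)
    then show ?thesis
      by (simp add: g_def o_def)
  qed
  have "1 < 1 / \<rho>"
    using \<rho> by simp
  from taylor_polynomial_uniform[OF holomorphic_deriv[OF g_hol open_ball] zero_less_one this d(1)]
  obtain Q where Q: "\<And>w. w \<in> cball 0 1 \<Longrightarrow> cmod (deriv g w - poly Q w) < d"
    by blast
  obtain P where P: "pderiv P = Q" "poly P 0 = f 0"
    using polynomial_antiderivative by blast
  have g_fin: "finite_dirichlet ?B g"
    using g by (simp add: g_def)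
  note gP = dirichlet_parallelogram(2)[OF open_ball g_fin finite_dirichlet_poly[of P]]
  have "dirichlet_integral ?B (\<lambda>z. g z - poly P z) \<le> set_lebesgue_integral lborel ?B (\<lambda>z. d\<^sup>2)"
    unfolding dirichlet_integral_def
  proof (rule set_integral_mono)
    fix z assume z: "z \<in> ?B"
    then have "z \<in> ball 0 (1 / \<rho>)"
      using \<open>1 < 1 / \<rho>\<close> by simp
    then have "g field_differentiable at z"
      using g_hol by (auto intro: holomorphic_on_imp_differentiable_at)
    moreover have "poly P field_differentiable at z"
      using poly_DERIV field_differentiable_def by blast
    ultimately have "deriv (\<lambda>z. g z - poly P z) z = deriv g z - poly Q z"
      by (simp add: deriv_poly P)
    then show "(cmod (deriv (\<lambda>z. g z - poly P z) z))\<^sup>2 \<le> d\<^sup>2"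
      using Q[of z] z by (intro power_mono) auto
  qed (use gP in \<open>auto simp: finite_dirichlet_def intro: set_integrable_ball_if_continuous_cball\<close>)
  also have "\<dots> = d\<^sup>2 * ?m"
    by (simp add: set_lebesgue_integral_def)
  finally have gP_le: "dirichlet_integral ?B (\<lambda>z. g z - poly P z) \<le> e / 8"
    using d by simp
  have "dirichlet_integral ?B (\<lambda>z. f z - poly P z) =
      dirichlet_integral ?B (\<lambda>z. (f z - g z) + (g z - poly P z))"
    by simp
  also have "\<dots> \<le> 2 * dirichlet_integral ?B (\<lambda>z. f z - g z) +
      2 * dirichlet_integral ?B (\<lambda>z. g z - poly P z)"
    by (intro dirichlet_integral_add_le open_ball gP dirichlet_parallelogram(2) f g_fin)
  also have "\<dots> < e"
    using fg gP_le e unfolding g_def by linarith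
  finally show ?thesis
    using that P(2) by blast
qed

section \<open>Transfer to the upper half-plane\<close>

lemma open_upper_half_plane: "open upper_half_plane"
  unfolding upper_half_plane_def by (rule open_halfspace_Im_gt)

lemma convex_upper_half_plane: "convex upper_half_plane"
  unfolding upper_half_plane_def by (rule convex_halfspace_Im_gt)

lemma imaginary_unit_in_upper_half_plane: "\<i> \<in> upper_half_plane"
  by (simp add: upper_half_plane_def)

lemma alpha_holomorphic: "alpha holomorphic_on ball 0 1"
  unfolding alpha_def
  by (intro holomorphic_intros) (auto simp: add_eq_0_iff)

lemma alpha_image: "alpha ` ball 0 1 = upper_half_plane"
  using alpha_in_upper_half_plane alpha_alpha_inv alpha_inv_in_disc
  by (metis image_eqI image_subsetI subsetI subset_antisym)

lemma alpha_inj: "inj_on alpha (ball 0 1)"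
  by (rule inj_on_inverseI[of _ alpha_inv]) (rule alpha_inv_alpha)

lemma alpha_inv_holomorphic: "alpha_inv holomorphic_on upper_half_plane"
  unfolding alpha_inv_def
  by (intro holomorphic_intros) (auto simp: upper_half_plane_def complex_eq_iff)

lemma poly_alpha_inv_holomorphic: "poly P \<circ> alpha_inv holomorphic_on upper_half_plane"
  by (intro holomorphic_on_compose alpha_inv_holomorphic holomorphic_intros)

lemma dirichlet_alpha:
  assumes "f holomorphic_on upper_half_plane"
  shows "finite_dirichlet (ball 0 1) (f \<circ> alpha) \<longleftrightarrow> finite_dirichlet upper_half_plane f"
    and "finite_dirichlet upper_half_plane f \<Longrightarrow>
      dirichlet_integral (ball 0 1) (f \<circ> alpha) = dirichlet_integral upper_half_plane f"
  using finite_dirichlet_conformal_iff[OF open_ball alpha_holomorphic alpha_inj, of f] assms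
  unfolding alpha_image by auto

text \<open>Composition with \<open>alpha\<close> turns the function into a polynomial on the disc.\<close>

lemma finite_dirichlet_poly_alpha_inv:
  "finite_dirichlet upper_half_plane (poly P \<circ> alpha_inv)"
proof -
  have "finite_dirichlet (ball 0 1) (poly P \<circ> alpha_inv \<circ> alpha)"
    using dirichlet_cong(1)[of "ball 0 1" "poly P \<circ> alpha_inv \<circ> alpha" "poly P"]
    by (simp add: finite_dirichlet_poly alpha_inv_alpha)
  then show ?thesis
    using dirichlet_alpha(1)[OF poly_alpha_inv_holomorphic] by blast
qed

text \<open>The map \<open>alpha\<close> transports the density of polynomials from the disc. It sends 0 to \<open>\<i>\<close>, so that
agreement at the centre of the disc becomes agreement at the base point of the norm.\<close>

lemma poly_alpha_inv_dense:
  assumes f: "finite_dirichlet upper_half_plane f" and e: "e > 0"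
  obtains P where "(poly P \<circ> alpha_inv) \<i> = f \<i>"
    "dirichlet_integral upper_half_plane (\<lambda>z. f z - (poly P \<circ> alpha_inv) z) < e"
proof -
  have f_hol: "f holomorphic_on upper_half_plane"
    using f by (simp add: finite_dirichlet_def)
  have "finite_dirichlet (ball 0 1) (f \<circ> alpha)"
    using dirichlet_alpha(1)[OF f_hol] f by blast
  from polynomials_dense_disc[OF this e] obtain P where P: "poly P 0 = (f \<circ> alpha) 0"
    "dirichlet_integral (ball 0 1) (\<lambda>z. (f \<circ> alpha) z - poly P z) < e" .
  let ?h = "\<lambda>z. f z - (poly P \<circ> alpha_inv) z"
  have h: "finite_dirichlet upper_half_plane ?h"
    by (intro dirichlet_parallelogram(2) open_upper_half_plane f finite_dirichlet_poly_alpha_inv)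
  then have "dirichlet_integral upper_half_plane ?h = dirichlet_integral (ball 0 1) (?h \<circ> alpha)"
    by (intro dirichlet_alpha(2)[symmetric]) (auto simp: finite_dirichlet_def)
  also have "\<dots> = dirichlet_integral (ball 0 1) (\<lambda>z. (f \<circ> alpha) z - poly P z)"
    by (intro dirichlet_cong(2)) (auto simp: alpha_inv_alpha)
  finally have "dirichlet_integral upper_half_plane ?h < e"
    using P(2) by simp
  moreover have "(poly P \<circ> alpha_inv) \<i> = f \<i>"
    using P(1) by (simp add: alpha_def alpha_inv_def)
  ultimately show ?thesis
    using that by blast
qed

section \<open>The Dirichlet norm\<close>

lemma mem_dirichlet_space_iff:
  assumes "open S"
  shows "f \<in> dirichlet_space S \<longleftrightarrow> finite_dirichlet S f \<and> (\<forall>z. z \<notin> S \<longrightarrow> f z = 0)"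
  using assms by (auto simp: dirichlet_space_def finite_dirichlet_def analytic_on_open)

lemma restrict_zero_mem_dirichlet_space:
  assumes "open S" "finite_dirichlet S f"
  shows "restrict_zero S f \<in> dirichlet_space S"
  using assms dirichlet_cong(1)[of S "restrict_zero S f" f]
  by (simp add: mem_dirichlet_space_iff restrict_zero_def)

lemma dirichlet_space_diff:
  assumes "open S" "f \<in> dirichlet_space S" "g \<in> dirichlet_space S"
  shows "(\<lambda>z. f z - g z) \<in> dirichlet_space S"
  using assms dirichlet_parallelogram(2)[of S f g] by (simp add: mem_dirichlet_space_iff)

lemma dirichlet_norm_eq: "dirichlet_norm p S f = sqrt ((cmod (f p))\<^sup>2 + dirichlet_integral S f)"
  by (simp add: dirichlet_norm_def dirichlet_integral_def)

lemma dirichlet_norm_power2: "(dirichlet_norm p S f)\<^sup>2 = (cmod (f p))\<^sup>2 + dirichlet_integral S f"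
  by (simp add: dirichlet_norm_eq dirichlet_integral_nonneg)

lemma dirichlet_norm_nonneg: "dirichlet_norm p S f \<ge> 0"
  by (simp add: dirichlet_norm_eq dirichlet_integral_nonneg)

lemma dirichlet_norm_cong:
  assumes "open S" "p \<in> S" "\<And>z. z \<in> S \<Longrightarrow> f z = g z"
  shows "dirichlet_norm p S f = dirichlet_norm p S g"
  using assms dirichlet_cong(2)[of S f g] by (simp add: dirichlet_norm_eq)

text \<open>The factor 2 makes this weaker than the triangle inequality, but it suffices for all
approximation arguments and follows directly from the parallelogram law.\<close>

lemma dirichlet_norm_add_le:
  assumes "open S" "finite_dirichlet S f" "finite_dirichlet S g"
  shows "dirichlet_norm p S (\<lambda>z. f z + g z) \<le> 2 * (dirichlet_norm p S f + dirichlet_norm p S g)"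
proof (rule power2_le_imp_le)
  let ?N = "dirichlet_norm p S"
  have "(cmod (f p + g p))\<^sup>2 \<le> (cmod (f p) + cmod (g p))\<^sup>2"
    by (intro power_mono norm_triangle_ineq) auto
  also have "\<dots> \<le> 2 * (cmod (f p))\<^sup>2 + 2 * (cmod (g p))\<^sup>2"
    using sum_squares_bound[of "cmod (f p)" "cmod (g p)"] by (simp add: power2_sum)
  finally have "(?N (\<lambda>z. f z + g z))\<^sup>2 \<le> 2 * (?N f)\<^sup>2 + 2 * (?N g)\<^sup>2"
    using dirichlet_integral_add_le[OF assms] by (simp add: dirichlet_norm_power2)
  also have "\<dots> \<le> (2 * (?N f + ?N g))\<^sup>2"
    using dirichlet_norm_nonneg[of p S] by (simp add: power2_sum power_mult_distrib)
  finally show "(?N (\<lambda>z. f z + g z))\<^sup>2 \<le> (2 * (?N f + ?N g))\<^sup>2" .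
qed (simp add: dirichlet_norm_nonneg)

lemma point_evaluation_norm_bounded:
  assumes S: "open S" "convex S" and pz: "p \<in> S" "z \<in> S"
  obtains K where "K \<ge> 0" "\<And>f. finite_dirichlet S f \<Longrightarrow> cmod (f z) \<le> K * dirichlet_norm p S f"
proof -
  obtain K where K: "K \<ge> 0"
    "\<And>f. finite_dirichlet S f \<Longrightarrow> (cmod (f z - f p))\<^sup>2 \<le> K * dirichlet_integral S f"
    using point_evaluation_bounded[OF S pz] by metis
  show ?thesis
  proof (rule that[of "1 + sqrt K"])
    fix f assume f: "finite_dirichlet S f"
    let ?D = "dirichlet_integral S f" and ?N = "dirichlet_norm p S f"
    have "cmod (f z) \<le> cmod (f p) + cmod (f z - f p)"
      by (rule norm_triangle_sub)
    also have "cmod (f p) \<le> ?N"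
      unfolding dirichlet_norm_eq by (intro real_le_rsqrt) (simp add: dirichlet_integral_nonneg)
    also have "cmod (f z - f p) \<le> sqrt (K * ?D)"
      by (rule real_le_rsqrt[OF K(2)[OF f]])
    also have "\<dots> \<le> sqrt K * ?N"
      unfolding real_sqrt_mult dirichlet_norm_eq using K(1)
      by (intro mult_left_mono) auto
    finally show "cmod (f z) \<le> (1 + sqrt K) * ?N"
      by (simp add: algebra_simps)
  qed (use K in auto)
qed

lemma dirichlet_norm_conformal:
  assumes S: "open S" and \<phi>: "\<phi> holomorphic_on S" "inj_on \<phi> S"
    and f: "finite_dirichlet (\<phi> ` S) f"
  shows "dirichlet_norm p S (f \<circ> \<phi>) = dirichlet_norm (\<phi> p) (\<phi> ` S) f"
  using finite_dirichlet_conformal_iff(2)[OF S \<phi> _ f] f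
  by (simp add: dirichlet_norm_eq finite_dirichlet_def)

lemma restrict_poly_alpha_inv_mem: "restrict_zero upper_half_plane (poly P \<circ> alpha_inv) \<in> R_alpha"
  by (auto simp: R_alpha_def)

lemma R_alpha_subset_dirichlet_space:
  assumes "r \<in> R_alpha"
  shows "r \<in> dirichlet_space upper_half_plane"
  using assms by (auto simp: R_alpha_def intro!: restrict_zero_mem_dirichlet_space
      open_upper_half_plane finite_dirichlet_poly_alpha_inv)

lemma R_alpha_dense:
  assumes "f \<in> dirichlet_space upper_half_plane" "e > 0"
  obtains r where "r \<in> R_alpha" "dirichlet_norm \<i> upper_half_plane (\<lambda>z. f z - r z) < e"
proof -
  have "finite_dirichlet upper_half_plane f" "e\<^sup>2 > 0"
    using assms by (auto simp: mem_dirichlet_space_iff open_upper_half_plane)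
  from poly_alpha_inv_dense[OF this] obtain P where P: "(poly P \<circ> alpha_inv) \<i> = f \<i>"
    "dirichlet_integral upper_half_plane (\<lambda>z. f z - (poly P \<circ> alpha_inv) z) < e\<^sup>2" .
  have "dirichlet_norm \<i> upper_half_plane (\<lambda>z. f z - restrict_zero upper_half_plane (poly P \<circ> alpha_inv) z) =
      dirichlet_norm \<i> upper_half_plane (\<lambda>z. f z - (poly P \<circ> alpha_inv) z)"
    by (intro dirichlet_norm_cong open_upper_half_plane imaginary_unit_in_upper_half_plane)
      (simp add: restrict_zero_def)
  also have "\<dots> < e"
    unfolding dirichlet_norm_eq using P assms(2) by (simp add: real_less_lsqrt)
  finally show ?thesis
    using that restrict_poly_alpha_inv_mem by blast
qed

section \<open>Composition operators\<close>

lemma composition_operator_apply: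
  "z \<in> upper_half_plane \<Longrightarrow> composition_operator \<phi> f z = f (\<phi> z)"
  by (simp add: composition_operator_def restrict_zero_def)

lemma composition_operator_add:
  "composition_operator \<phi> (\<lambda>z. f z + g z) = (\<lambda>z. composition_operator \<phi> f z + composition_operator \<phi> g z)"
  by (auto simp: composition_operator_def restrict_zero_def)

lemma composition_operator_diff:
  "composition_operator \<phi> (\<lambda>z. f z - g z) = (\<lambda>z. composition_operator \<phi> f z - composition_operator \<phi> g z)"
  by (auto simp: composition_operator_def restrict_zero_def)

lemma composition_operator_cmult:
  "composition_operator \<phi> (\<lambda>z. c * f z) = (\<lambda>z. c * composition_operator \<phi> f z)"
  by (auto simp: composition_operator_def restrict_zero_def)

text \<open>For univalent \<open>\<phi>\<close> composition is an isometry from the Dirichlet space of the image, normalised at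
\<open>\<phi> \<i>\<close>, into that of the half-plane.\<close>

lemma composition_operator_conformal:
  assumes \<phi>: "\<phi> holomorphic_on upper_half_plane" "inj_on \<phi> upper_half_plane"
    and f: "finite_dirichlet (\<phi> ` upper_half_plane) f"
  shows "composition_operator \<phi> f \<in> dirichlet_space upper_half_plane"
    and "dirichlet_norm \<i> upper_half_plane (composition_operator \<phi> f) =
      dirichlet_norm (\<phi> \<i>) (\<phi> ` upper_half_plane) f"
proof -
  have "finite_dirichlet upper_half_plane (f \<circ> \<phi>)"
    using finite_dirichlet_conformal_iff(1)[OF open_upper_half_plane \<phi>, of f] f
    by (auto simp: finite_dirichlet_def)
  then show "composition_operator \<phi> f \<in> dirichlet_space upper_half_plane"
    unfolding composition_operator_def
    by (intro restrict_zero_mem_dirichlet_space open_upper_half_plane)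
  have "dirichlet_norm \<i> upper_half_plane (composition_operator \<phi> f) =
      dirichlet_norm \<i> upper_half_plane (f \<circ> \<phi>)"
    by (intro dirichlet_norm_cong open_upper_half_plane imaginary_unit_in_upper_half_plane)
       (simp add: composition_operator_apply)
  then show "dirichlet_norm \<i> upper_half_plane (composition_operator \<phi> f) =
      dirichlet_norm (\<phi> \<i>) (\<phi> ` upper_half_plane) f"
    using dirichlet_norm_conformal[OF open_upper_half_plane \<phi> f] by simp
qed

text \<open>If \<open>\<phi> a = \<phi> b\<close>, evaluation at \<open>a\<close> minus evaluation at \<open>b\<close> is a bounded functional that vanishes on
the dense range. It then vanishes on \<open>alpha_inv\<close>, which is injective on the half-plane.\<close>

lemma inj_on_if_composition_range_dense:
  assumes dense: "dense_in (dirichlet_space upper_half_plane) (dirichlet_norm \<i> upper_half_plane)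
      (composition_operator \<phi> ` dirichlet_space upper_half_plane)"
  shows "inj_on \<phi> upper_half_plane"
proof (rule inj_onI)
  let ?U = upper_half_plane
  fix a b assume ab: "a \<in> ?U" "b \<in> ?U" and eq: "\<phi> a = \<phi> b"
  note eval = point_evaluation_norm_bounded[OF open_upper_half_plane convex_upper_half_plane
      imaginary_unit_in_upper_half_plane]
  obtain K where K: "K \<ge> 0" "\<And>f. finite_dirichlet ?U f \<Longrightarrow> cmod (f a) \<le> K * dirichlet_norm \<i> ?U f"
    using eval[OF ab(1)] by metis
  obtain L where L: "L \<ge> 0" "\<And>f. finite_dirichlet ?U f \<Longrightarrow> cmod (f b) \<le> L * dirichlet_norm \<i> ?U f"
    using eval[OF ab(2)] by metis
  \<comment> \<open>The polynomial \<open>[:0, 1:]\<close> is the identity, so this is \<open>alpha_inv\<close> as an element of the space.\<close>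
  define s where "s = restrict_zero ?U (poly [:0, 1:] \<circ> alpha_inv)"
  have s: "s \<in> dirichlet_space ?U"
    unfolding s_def by (intro R_alpha_subset_dirichlet_space restrict_poly_alpha_inv_mem)
  have s_apply: "s z = alpha_inv z" if "z \<in> ?U" for z
    using that by (simp add: s_def restrict_zero_def)
  have "cmod (s a - s b) \<le> 0 + e" if e: "e > 0" for e :: real
  proof -
    have "e / (K + L + 1) > 0"
      using e K(1) L(1) by simp
    then obtain f where f: "f \<in> dirichlet_space ?U"
      and close: "dirichlet_norm \<i> ?U (\<lambda>z. s z - composition_operator \<phi> f z) < e / (K + L + 1)"
      and mem: "composition_operator \<phi> f \<in> dirichlet_space ?U"
      using dense s unfolding dense_in_def by blast
    let ?d = "\<lambda>z. s z - composition_operator \<phi> f z"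
    have d: "finite_dirichlet ?U ?d"
      using dirichlet_space_diff[OF open_upper_half_plane s mem]
      by (simp add: mem_dirichlet_space_iff open_upper_half_plane)
    have "s a - s b = ?d a - ?d b"
      using ab eq by (simp add: composition_operator_apply)
    then have "cmod (s a - s b) \<le> cmod (?d a) + cmod (?d b)"
      using norm_triangle_ineq4 by metis
    also have "\<dots> \<le> (K + L) * dirichlet_norm \<i> ?U ?d"
      using K(2)[OF d] L(2)[OF d] by (simp add: algebra_simps)
    also have "\<dots> \<le> (K + L) * (e / (K + L + 1))"
      using close K(1) L(1) by (intro mult_left_mono) auto
    also have "\<dots> \<le> e"
      using K(1) L(1) e by (simp add: divide_simps)
    finally show ?thesis by simp
  qed
  then have "cmod (s a - s b) \<le> 0"
    by (rule field_le_epsilon)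
  then have "alpha_inv a = alpha_inv b"
    using ab by (simp add: s_apply)
  then show "a = b"
    using ab by (metis alpha_alpha_inv)
qed

text \<open>By the isometry, the norm of the composition is the norm of \<open>f\<close> on the image, normalised at
\<open>\<phi> \<i>\<close>. The integral over the image is at most that over the half-plane, and the value at \<open>\<phi> \<i>\<close> is
controlled by the boundedness of point evaluation.\<close>

lemma bounded_composition_operator:
  assumes \<phi>: "\<phi> holomorphic_on upper_half_plane" "inj_on \<phi> upper_half_plane"
    and self: "\<phi> ` upper_half_plane \<subseteq> upper_half_plane"
  shows "bounded_operator_on (dirichlet_space upper_half_plane)
      (dirichlet_norm \<i> upper_half_plane) (composition_operator \<phi>)"
proof -
  let ?U = upper_half_plane and ?\<Omega> = "\<phi> ` upper_half_plane"
  have open_\<Omega>: "open ?\<Omega>"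
    using open_mapping_thm3[OF \<phi>(1) open_upper_half_plane \<phi>(2)] .
  have fin: "finite_dirichlet ?U f" if "f \<in> dirichlet_space ?U" for f
    using that by (simp add: mem_dirichlet_space_iff open_upper_half_plane)
  have "\<phi> \<i> \<in> ?U"
    using self imaginary_unit_in_upper_half_plane by blast
  then obtain K where K: "K \<ge> 0"
    "\<And>f. finite_dirichlet ?U f \<Longrightarrow> cmod (f (\<phi> \<i>)) \<le> K * dirichlet_norm \<i> ?U f"
    using point_evaluation_norm_bounded[OF open_upper_half_plane convex_upper_half_plane
        imaginary_unit_in_upper_half_plane] by metis
  have "dirichlet_norm \<i> ?U (composition_operator \<phi> f) \<le> (K + 1) * dirichlet_norm \<i> ?U f"
    if f: "f \<in> dirichlet_space ?U" for f
  proof -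
    let ?N = "dirichlet_norm \<i> ?U f"
    note sub = finite_dirichlet_subset[OF fin[OF f] open_\<Omega> self]
    have "dirichlet_norm \<i> ?U (composition_operator \<phi> f) = dirichlet_norm (\<phi> \<i>) ?\<Omega> f"
      by (rule composition_operator_conformal(2)[OF \<phi> sub(1)])
    also have "\<dots> \<le> sqrt ((cmod (f (\<phi> \<i>)))\<^sup>2) + sqrt (dirichlet_integral ?\<Omega> f)"
      unfolding dirichlet_norm_eq by (intro sqrt_add_le_add_sqrt) (auto simp: dirichlet_integral_nonneg)
    also have "\<dots> \<le> cmod (f (\<phi> \<i>)) + ?N"
      using sub(2) by (simp add: dirichlet_norm_eq add_increasing)
    also have "\<dots> \<le> (K + 1) * ?N"
      using K(2)[OF fin[OF f]] by (simp add: algebra_simps)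
    finally show ?thesis .
  qed
  moreover have "composition_operator \<phi> f \<in> dirichlet_space ?U" if "f \<in> dirichlet_space ?U" for f
    using composition_operator_conformal(1)[OF \<phi>] finite_dirichlet_subset(1)[OF fin open_\<Omega> self] that
    by blast
  ultimately show ?thesis
    unfolding bounded_operator_on_def
    by (auto simp: composition_operator_add composition_operator_cmult)
qed

text \<open>Every \<open>g\<close> on the half-plane is \<open>h \<circ> \<phi>\<close> with \<open>h = g \<circ> \<phi>\<^sup>-\<^sup>1\<close> in the Dirichlet space of the image.
If a rational function \<open>r\<close> is close to \<open>h\<close>, then \<open>r \<circ> \<phi>\<close> is equally close to \<open>g\<close>. It lies in the
range because \<open>r\<close> has finite Dirichlet integral over the whole half-plane.\<close>

lemma composition_range_dense:
  assumes \<phi>: "\<phi> holomorphic_on upper_half_plane" "inj_on \<phi> upper_half_plane"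
    and self: "\<phi> ` upper_half_plane \<subseteq> upper_half_plane"
    and dense: "dense_in (dirichlet_space (\<phi> ` upper_half_plane))
      (dirichlet_norm (\<phi> \<i>) (\<phi> ` upper_half_plane))
      (restrict_zero (\<phi> ` upper_half_plane) ` R_alpha)"
  shows "dense_in (dirichlet_space upper_half_plane) (dirichlet_norm \<i> upper_half_plane)
      (composition_operator \<phi> ` dirichlet_space upper_half_plane)"
  unfolding dense_in_def
proof (intro conjI ballI allI impI)
  let ?U = upper_half_plane and ?\<Omega> = "\<phi> ` upper_half_plane"
  have open_\<Omega>: "open ?\<Omega>"
    using open_mapping_thm3[OF \<phi>(1) open_upper_half_plane \<phi>(2)] .
  show "composition_operator \<phi> ` dirichlet_space ?U \<subseteq> dirichlet_space ?U"
    using bounded_composition_operator[OF \<phi> self] by (auto simp: bounded_operator_on_def)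
  fix g and e :: real assume g: "g \<in> dirichlet_space ?U" and e: "e > 0"
  obtain \<psi> where \<psi>: "\<psi> holomorphic_on ?\<Omega>" "\<And>z. z \<in> ?U \<Longrightarrow> \<psi> (\<phi> z) = z"
    using holomorphic_has_inverse[OF \<phi>(1) open_upper_half_plane \<phi>(2)] by metis
  have g_fin: "finite_dirichlet ?U g"
    using g by (simp add: mem_dirichlet_space_iff open_upper_half_plane)
  have g\<psi>_hol: "g \<circ> \<psi> holomorphic_on ?\<Omega>"
    using \<psi> g_fin by (intro holomorphic_on_compose_gen[where t = ?U]) (auto simp: finite_dirichlet_def)
  have "finite_dirichlet ?U (g \<circ> \<psi> \<circ> \<phi>)"
    using g_fin dirichlet_cong(1)[OF open_upper_half_plane, of "g \<circ> \<psi> \<circ> \<phi>" g] by (simp add: \<psi>(2))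
  then have "finite_dirichlet ?\<Omega> (g \<circ> \<psi>)"
    using finite_dirichlet_conformal_iff(1)[OF open_upper_half_plane \<phi> g\<psi>_hol] by blast
  then have h: "restrict_zero ?\<Omega> (g \<circ> \<psi>) \<in> dirichlet_space ?\<Omega>" (is "?h \<in> _")
    by (intro restrict_zero_mem_dirichlet_space open_\<Omega>)
  then obtain r where r: "r \<in> R_alpha" "restrict_zero ?\<Omega> r \<in> dirichlet_space ?\<Omega>"
    and close: "dirichlet_norm (\<phi> \<i>) ?\<Omega> (\<lambda>z. ?h z - restrict_zero ?\<Omega> r z) < e"
    using dense e unfolding dense_in_def by blast
  let ?d = "\<lambda>z. ?h z - restrict_zero ?\<Omega> r z"
  have d: "finite_dirichlet ?\<Omega> ?d"
    using dirichlet_space_diff[OF open_\<Omega> h r(2)] by (simp add: mem_dirichlet_space_iff open_\<Omega>)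
  have "dirichlet_norm \<i> ?U (\<lambda>z. g z - composition_operator \<phi> r z) =
      dirichlet_norm \<i> ?U (composition_operator \<phi> ?d)"
    by (intro dirichlet_norm_cong open_upper_half_plane imaginary_unit_in_upper_half_plane)
       (auto simp: composition_operator_apply restrict_zero_def \<psi>(2))
  also have "\<dots> = dirichlet_norm (\<phi> \<i>) ?\<Omega> ?d"
    by (rule composition_operator_conformal(2)[OF \<phi> d])
  finally show "\<exists>f\<in>composition_operator \<phi> ` dirichlet_space ?U. dirichlet_norm \<i> ?U (\<lambda>z. g z - f z) < e"
    using close by (intro bexI[OF _ imageI[OF R_alpha_subset_dirichlet_space[OF r(1)]]]) simp
qed

text \<open>Here \<open>f \<circ> \<phi>\<close> is close to some \<open>g \<circ> \<phi>\<close> by hypothesis, and \<open>g\<close> is close to a rational function \<open>r\<close>.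
The operator is bounded, so \<open>g \<circ> \<phi>\<close> is close to \<open>r \<circ> \<phi>\<close>, and the isometry brings the estimate back
to the image.\<close>

lemma R_alpha_dense_in_image:
  assumes \<phi>: "\<phi> holomorphic_on upper_half_plane" "inj_on \<phi> upper_half_plane"
    and self: "\<phi> ` upper_half_plane \<subseteq> upper_half_plane"
    and dense: "dense_in (dirichlet_space upper_half_plane) (dirichlet_norm \<i> upper_half_plane)
      (composition_operator \<phi> ` dirichlet_space upper_half_plane)"
  shows "dense_in (dirichlet_space (\<phi> ` upper_half_plane))
      (dirichlet_norm (\<phi> \<i>) (\<phi> ` upper_half_plane))
      (restrict_zero (\<phi> ` upper_half_plane) ` R_alpha)"
  unfolding dense_in_def
proof (intro conjI ballI allI impI)
  let ?U = upper_half_plane and ?\<Omega> = "\<phi> ` upper_half_plane"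
  let ?C = "composition_operator \<phi>" and ?N = "dirichlet_norm \<i> upper_half_plane"
  have open_\<Omega>: "open ?\<Omega>"
    using open_mapping_thm3[OF \<phi>(1) open_upper_half_plane \<phi>(2)] .
  have fin: "finite_dirichlet ?U f" if "f \<in> dirichlet_space ?U" for f
    using that by (simp add: mem_dirichlet_space_iff open_upper_half_plane)
  have fin_\<Omega>: "finite_dirichlet ?\<Omega> f" if "f \<in> dirichlet_space ?\<Omega>" for f
    using that by (simp add: mem_dirichlet_space_iff open_\<Omega>)
  have bounded: "bounded_operator_on (dirichlet_space ?U) ?N ?C"
    by (rule bounded_composition_operator[OF \<phi> self])
  have R: "restrict_zero ?\<Omega> r \<in> dirichlet_space ?\<Omega>" if "r \<in> R_alpha" for r
    by (intro restrict_zero_mem_dirichlet_space open_\<Omega>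
        finite_dirichlet_subset(1)[OF fin[OF R_alpha_subset_dirichlet_space[OF that]] open_\<Omega> self])
  then show "restrict_zero ?\<Omega> ` R_alpha \<subseteq> dirichlet_space ?\<Omega>"
    by blast
  fix f and e :: real assume f: "f \<in> dirichlet_space ?\<Omega>" and e: "e > 0"
  obtain K where K: "\<And>g. g \<in> dirichlet_space ?U \<Longrightarrow> ?N (?C g) \<le> K * ?N g"
    using bounded unfolding bounded_operator_on_def by blast
  have Cf: "?C f \<in> dirichlet_space ?U"
    by (rule composition_operator_conformal(1)[OF \<phi> fin_\<Omega>[OF f]])
  have "e / 4 > 0"
    using e by simp
  then obtain g where g: "g \<in> dirichlet_space ?U" "?C g \<in> dirichlet_space ?U"
    and fg: "?N (\<lambda>z. ?C f z - ?C g z) < e / 4"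
    using dense Cf unfolding dense_in_def by blast
  \<comment> \<open>Each of the two approximations is to contribute less than \<open>e / 4\<close>, since the sum is
    doubled at the end; \<open>\<bar>K\<bar> + 1\<close> is a positive bound for the operator.\<close>
  have "e / (4 * (\<bar>K\<bar> + 1)) > 0"
    using e by (simp add: add_nonneg_pos)
  from R_alpha_dense[OF g(1) this] obtain r where r: "r \<in> R_alpha"
    and gr: "?N (\<lambda>z. g z - r z) < e / (4 * (\<bar>K\<bar> + 1))" .
  have gr_mem: "(\<lambda>z. g z - r z) \<in> dirichlet_space ?U"
    by (intro dirichlet_space_diff open_upper_half_plane g R_alpha_subset_dirichlet_space r)
  have "?N (\<lambda>z. ?C g z - ?C r z) \<le> K * ?N (\<lambda>z. g z - r z)"
    using K[OF gr_mem] by (simp add: composition_operator_diff)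
  also have "\<dots> \<le> (\<bar>K\<bar> + 1) * ?N (\<lambda>z. g z - r z)"
    by (intro mult_right_mono dirichlet_norm_nonneg) auto
  also have "\<dots> < e / 4"
    using gr by (simp add: field_simps add_nonneg_pos)
  finally have CgCr: "?N (\<lambda>z. ?C g z - ?C r z) < e / 4" .
  have Cr: "?C r \<in> dirichlet_space ?U"
    using bounded R_alpha_subset_dirichlet_space[OF r] by (simp add: bounded_operator_on_def)
  let ?d = "\<lambda>z. f z - restrict_zero ?\<Omega> r z"
  have d: "finite_dirichlet ?\<Omega> ?d"
    by (intro fin_\<Omega> dirichlet_space_diff open_\<Omega> f R r)
  have "dirichlet_norm (\<phi> \<i>) ?\<Omega> ?d = ?N (?C ?d)"
    by (rule composition_operator_conformal(2)[OF \<phi> d, symmetric])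
  also have "\<dots> = ?N (\<lambda>z. (?C f z - ?C g z) + (?C g z - ?C r z))"
    by (intro dirichlet_norm_cong open_upper_half_plane imaginary_unit_in_upper_half_plane)
       (auto simp: composition_operator_apply restrict_zero_def)
  also have "\<dots> \<le> 2 * (?N (\<lambda>z. ?C f z - ?C g z) + ?N (\<lambda>z. ?C g z - ?C r z))"
    by (intro dirichlet_norm_add_le open_upper_half_plane fin dirichlet_space_diff Cf g Cr)
  also have "\<dots> < e"
    using add_strict_mono[OF fg CgCr] by simp
  finally show "\<exists>h\<in>restrict_zero ?\<Omega> ` R_alpha. dirichlet_norm (\<phi> \<i>) ?\<Omega> (\<lambda>z. f z - h z) < e"
    using r by blast
qed

theorem theorem4p1:
  fixes \<phi> :: "complex \<Rightarrow> complex" and \<Omega> :: "complex set"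
  assumes "\<phi> analytic_on upper_half_plane"
    and "\<phi> ` upper_half_plane \<subseteq> upper_half_plane"
    and "\<Omega> = \<phi> ` upper_half_plane"
  shows "(bounded_operator_on (dirichlet_space upper_half_plane)
            (dirichlet_norm \<i> upper_half_plane) (composition_operator \<phi>) \<and>
          dense_in (dirichlet_space upper_half_plane) (dirichlet_norm \<i> upper_half_plane)
            (composition_operator \<phi> ` dirichlet_space upper_half_plane))
     \<longleftrightarrow> (univalent_on \<phi> upper_half_plane \<and>
          dense_in (dirichlet_space \<Omega>) (dirichlet_norm (\<phi> \<i>) \<Omega>)
            (restrict_zero \<Omega> ` R_alpha))"
proof -
  have hol: "\<phi> holomorphic_on upper_half_plane"
    using assms(1) by (rule analytic_imp_holomorphic)
  show ?thesis
    unfolding assms(3) univalent_on_def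
    using assms(1,2) inj_on_if_composition_range_dense bounded_composition_operator[OF hol]
      composition_range_dense[OF hol] R_alpha_dense_in_image[OF hol]
    by blast
qed

end
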